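(* Let $A$ be a finite alphabet, let $K\neq 1$ be a nontrivial finitely generated subgroup of the free group $F_A$, and let $M(K)$ be the transition monoid of its Stallings automaton $\mathcal S(K)=(Q,A,\delta,q_0)$. Then $K$ is normal in $F_A$ if and only if $M(K)$ is a group of size $|Q|$.
   Context: Let $A^{-1}$ be the set of formal inverses of the letters of $A$ and $\widetilde A = A\cup A^{-1}$. Elements of $F_A$ are identified with reduced words in the free monoid $\widetilde A^*$. Stallings automaton. Let $K=\langle u_1,\dots,u_k\rangle\leq F_A$ be finitely generated, with the $u_i$ nonempty reduced words in $\widetilde A^*$. Take a basepoint $q_0$, attach to it $k$ closed paths (petals) labeled $u_1,\dots,u_k$ with otherwise disjoint new vertices, and add for every edge $p\xrightarrow{a}q$ ($a\in\widetilde A$) its inverse edge $q\xrightarrow{a^{-1}}p$. Then successively identify ("fold") pairs of distinct edges $p\xrightarrow{a}q$, $p\xrightarrow{a}r$ ($a\in\widetilde A$), together with their inverse edges (so $q$ and $r$ are merged), until the automaton is deterministic. The result, with $q_0$ as unique initial and terminal state, is the Stallings automaton $\mathcal S(K)=(Q,A,\delta,q_0)$; up to isomorphism it depends only on $K$ and $A$. For $q\in Q$ and $u\in\widetilde A^*$, $q\cdot u$ denotes the vertex reached by reading $u$ from $q$, if this is possible (otherwise it is undefined), and $\delta_u$ is the partial transformation $q\mapsto q\cdot u$ of $Q$. The transition monoid is $M(K)=\{\delta_u \mid u\in\widetilde A^*\}$ under composition (left to right). *)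

theory Defs
  imports "HOL-Algebra.Algebra"
begin

text \<open>The letter \<open>(a, True)\<close> stands for the generator \<open>a\<close> and \<open>(a, False)\<close> for its formal inverse, so
  the involutive alphabet over \<open>A\<close> is \<open>A \<times> UNIV\<close>.\<close>

type_synonym 'a letter = "'a \<times> bool"

definition letter_inv :: "'a letter \<Rightarrow> 'a letter" where
  "letter_inv x = (fst x, \<not> snd x)"

definition reduced :: "'a letter list \<Rightarrow> bool" where
  "reduced w \<longleftrightarrow> successively (\<lambda>x y. y \<noteq> letter_inv x) w"

fun cancel_cons :: "'a letter \<Rightarrow> 'a letter list \<Rightarrow> 'a letter list" where
  "cancel_cons x [] = [x]"
| "cancel_cons x (y # w) = (if y = letter_inv x then w else x # y # w)"

definition reduce :: "'a letter list \<Rightarrow> 'a letter list" where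
  "reduce w = foldr cancel_cons w []"

definition free_group :: "'a set \<Rightarrow> 'a letter list monoid" where
  "free_group A =
    \<lparr>carrier = {w \<in> lists (A \<times> UNIV). reduced w},
     monoid.mult = (\<lambda>u v. reduce (u @ v)), one = []\<rparr>"

lemma letter_inv_inv [simp]: "letter_inv (letter_inv x) = x"
  by (simp add: letter_inv_def)

lemma reduced_Nil [simp]: "reduced []"
  by (simp add: reduced_def)

lemma reduced_cancel_cons: "reduced w \<Longrightarrow> reduced (cancel_cons x w)"
  by (cases w) (auto simp: reduced_def successively_Cons)

lemma reduced_foldr: "reduced w \<Longrightarrow> reduced (foldr cancel_cons u w)"
  by (induction u) (auto intro: reduced_cancel_cons)

lemma reduced_reduce: "reduced (reduce w)"
  by (simp add: reduce_def reduced_foldr)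

lemma cancel_cons_inverse:
  assumes "reduced w"
  shows "cancel_cons (letter_inv x) (cancel_cons x w) = w"
proof (cases w)
  case (Cons y v)
  then show ?thesis
    using assms by (cases v) (auto simp: reduced_def)
qed simp

lemma foldr_cancel_cons:
  assumes "reduced w"
  shows "foldr cancel_cons (cancel_cons x u) w = cancel_cons x (foldr cancel_cons u w)"
proof (cases u)
  case (Cons y v)
  then show ?thesis
    using cancel_cons_inverse[OF reduced_foldr[OF assms, of v], of y]
    by auto
qed simp

lemma foldr_reduce: "reduced w \<Longrightarrow> foldr cancel_cons (reduce u) w = foldr cancel_cons u w"
  by (induction u) (simp_all add: reduce_def foldr_cancel_cons)

lemma reduce_reduced: "reduced w \<Longrightarrow> reduce w = w"
proof (induction w)
  case (Cons x w)
  then show ?case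
    by (cases w) (auto simp: reduce_def reduced_def)
qed (simp add: reduce_def)

lemma reduce_append: "reduce (u @ v) = foldr cancel_cons u (reduce v)"
  by (simp add: reduce_def)

lemma cancel_cons_lists:
  "x \<in> B \<Longrightarrow> w \<in> lists B \<Longrightarrow> cancel_cons x w \<in> lists B"
  by (cases w) auto

lemma reduce_lists: "w \<in> lists B \<Longrightarrow> reduce w \<in> lists B"
  unfolding reduce_def
proof (induction w)
  case (Cons x w)
  then show ?case
    using cancel_cons_lists[of x B "foldr cancel_cons w []"] by simp
qed simp

lemma reduce_inverse: "reduce (rev (map letter_inv w) @ w) = []"
proof -
  have "foldr cancel_cons (rev (map letter_inv w)) (foldr cancel_cons w v) = v"
    if "reduced v" for v
    using that by (induction w) (simp_all add: cancel_cons_inverse reduced_foldr)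
  from this[of "[]"] show ?thesis
    by (simp add: reduce_def)
qed

lemma group_free_group: "group (free_group A)"
proof (rule groupI)
  fix x assume x: "x \<in> carrier (free_group A)"
  let ?y = "reduce (rev (map letter_inv x))"
  have "rev (map letter_inv x) \<in> lists (A \<times> UNIV)"
    using x by (fastforce simp: free_group_def letter_inv_def)
  then have "?y \<in> carrier (free_group A)"
    using reduced_reduce[of "rev (map letter_inv x)"] reduce_lists[of "rev (map letter_inv x)"]
    by (simp add: free_group_def)
  moreover have "reduce (?y @ x) = []"
    using x reduce_inverse[of x]
    by (simp add: free_group_def reduce_append reduce_reduced foldr_reduce)
  ultimately show "\<exists>y\<in>carrier (free_group A). y \<otimes>\<^bsub>free_group A\<^esub> x = \<one>\<^bsub>free_group A\<^esub>"
    by (auto simp: free_group_def)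
next
  fix x y assume "x \<in> carrier (free_group A)" "y \<in> carrier (free_group A)"
  then show "x \<otimes>\<^bsub>free_group A\<^esub> y \<in> carrier (free_group A)"
    using reduced_reduce[of "x @ y"] reduce_lists[of "x @ y"] by (simp add: free_group_def)
next
  fix x y z
  assume "x \<in> carrier (free_group A)" "y \<in> carrier (free_group A)" "z \<in> carrier (free_group A)"
  then have "reduced y" "reduced z"
    by (simp_all add: free_group_def)
  then have "reduce (reduce (x @ y) @ z) = reduce (x @ reduce (y @ z))"
    by (simp add: reduce_append[of "reduce (x @ y)"] reduce_append[of x "reduce (y @ z)"]
        foldr_reduce reduced_reduce reduce_reduced) (simp add: reduce_append reduce_reduced)
  then show "x \<otimes>\<^bsub>free_group A\<^esub> y \<otimes>\<^bsub>free_group A\<^esub> z = x \<otimes>\<^bsub>free_group A\<^esub> (y \<otimes>\<^bsub>free_group A\<^esub> z)"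
    by (simp add: free_group_def)
qed (auto simp: free_group_def reduce_reduced)

record ('v, 'a) automaton =
  states :: "'v set"
  edges :: "('v \<times> 'a letter \<times> 'v) set"
  base :: 'v

datatype vertex = Base | Petal nat nat

text \<open>\<open>petal_vertex us i j\<close> is the vertex reached after \<open>j\<close> letters of the \<open>i\<close>-th petal, which is a
  closed path at the basepoint.\<close>

definition petal_vertex :: "'a letter list list \<Rightarrow> nat \<Rightarrow> nat \<Rightarrow> vertex" where
  "petal_vertex us i j = (if j = 0 \<or> j = length (us ! i) then Base else Petal i j)"

definition petal_edges :: "'a letter list list \<Rightarrow> (vertex \<times> 'a letter \<times> vertex) set" where
  "petal_edges us =
    {(petal_vertex us i j, us ! i ! j, petal_vertex us i (Suc j)) | i j.
      i < length us \<and> j < length (us ! i)}"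

definition flower :: "'a letter list list \<Rightarrow> (vertex, 'a) automaton" where
  "flower us =
    \<lparr>states = insert Base {petal_vertex us i j | i j. i < length us \<and> j < length (us ! i)},
     edges = petal_edges us \<union> {(q, letter_inv x, p) | p x q. (p, x, q) \<in> petal_edges us},
     base = Base\<rparr>"

definition map_automaton :: "('v \<Rightarrow> 'w) \<Rightarrow> ('v, 'a) automaton \<Rightarrow> ('w, 'a) automaton" where
  "map_automaton f S =
    \<lparr>states = f ` states S, edges = (\<lambda>(p, x, q). (f p, x, f q)) ` edges S, base = f (base S)\<rparr>"

text \<open>Merging \<open>r\<close> into \<open>q\<close> identifies the two edges and, since edges form a set closed under
  inversion, also their inverse edges.\<close>

inductive fold_step :: "('v, 'a) automaton \<Rightarrow> ('v, 'a) automaton \<Rightarrow> bool" where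
  "(p, x, q) \<in> edges S \<Longrightarrow> (p, x, r) \<in> edges S \<Longrightarrow> q \<noteq> r \<Longrightarrow>
    fold_step S (map_automaton (id(r := q)) S)"

definition deterministic :: "('v, 'a) automaton \<Rightarrow> bool" where
  "deterministic S \<longleftrightarrow> (\<forall>p x q r. (p, x, q) \<in> edges S \<longrightarrow> (p, x, r) \<in> edges S \<longrightarrow> q = r)"

text \<open>The Stallings automaton is only determined up to isomorphism, so it is rendered as a predicate
  that holds of every result of every complete folding process, for every choice of generators.\<close>

definition stallings_automaton ::
  "'a set \<Rightarrow> 'a letter list set \<Rightarrow> (vertex, 'a) automaton \<Rightarrow> bool" where
  "stallings_automaton A K S \<longleftrightarrow>
    (\<exists>us. set us \<subseteq> carrier (free_group A) - {[]} \<and> K = generate (free_group A) (set us) \<and>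
      fold_step\<^sup>*\<^sup>* (flower us) S \<and> deterministic S)"

definition finitely_generated :: "('g, 'm) monoid_scheme \<Rightarrow> 'g set \<Rightarrow> bool" where
  "finitely_generated G H \<longleftrightarrow> (\<exists>U. finite U \<and> U \<subseteq> carrier G \<and> H = generate G U)"

lemma finite_states_flower: "finite (states (flower us))"
proof -
  have "states (flower us) \<subseteq>
      insert Base (\<Union>i<length us. petal_vertex us i ` {..<length (us ! i)})"
    by (auto simp: flower_def)
  then show ?thesis
    by (rule finite_subset) auto
qed

lemma edges_flower:
  assumes "(p, x, q) \<in> edges (flower us)"
  shows "p \<in> states (flower us) \<and> q \<in> states (flower us)"
proof -
  have *: "petal_vertex us i j \<in> states (flower us)" if "i < length us" "j \<le> length (us ! i)" for i j
  proof (cases "j = length (us ! i)")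
    case True
    then show ?thesis by (simp add: flower_def petal_vertex_def)
  next
    case False
    then show ?thesis using that by (force simp: flower_def)
  qed
  from assms show ?thesis
    using * by (auto simp: flower_def petal_edges_def simp del: automaton.simps(1))
qed

lemma folding_terminates:
  assumes "finite (states S)" and "\<And>p x q. (p, x, q) \<in> edges S \<Longrightarrow> p \<in> states S \<and> q \<in> states S"
  shows "\<exists>T. fold_step\<^sup>*\<^sup>* S T \<and> deterministic T"
  using assms
proof (induction "card (states S)" arbitrary: S rule: less_induct)
  case less
  show ?case
  proof (cases "deterministic S")
    case False
    then obtain p x q r where e: "(p, x, q) \<in> edges S" "(p, x, r) \<in> edges S" "q \<noteq> r"
      by (auto simp: deterministic_def)
    let ?f = "id(r := q)" and ?T = "map_automaton (id(r := q)) S"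
    have r: "q \<in> states S" "r \<in> states S"
      using less.prems(2) e by blast+
    then have "states ?T = states S - {r}"
      using \<open>q \<noteq> r\<close> by (auto simp: map_automaton_def)
    moreover have "p' \<in> states ?T \<and> q' \<in> states ?T" if "(p', y, q') \<in> edges ?T" for p' y q'
      using that less.prems(2) by (auto simp: map_automaton_def simp del: fun_upd_apply)
    moreover have "card (states S - {r}) < card (states S)"
      using r(2) less.prems(1) by (meson card_Diff1_less)
    ultimately obtain T where "fold_step\<^sup>*\<^sup>* ?T T" "deterministic T"
      using less.hyps[of ?T] less.prems(1) by auto
    then show ?thesis
      using fold_step.intros[OF e] by (meson converse_rtranclp_into_rtranclp)
  qed auto
qed

lemma stallings_automaton_exists:
  assumes "finitely_generated (free_group A) K"
  shows "\<exists>S. stallings_automaton A K S"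
proof -
  interpret F: group "free_group A"
    by (rule group_free_group)
  obtain U where U: "finite U" "U \<subseteq> carrier (free_group A)" "K = generate (free_group A) U"
    using assms by (auto simp: finitely_generated_def)
  have one: "\<one>\<^bsub>free_group A\<^esub> = []"
    by (simp add: free_group_def)
  have "g \<in> generate (free_group A) (U - {[]})" if "g \<in> generate (free_group A) U" for g
    using that
  proof (induction rule: generate.induct)
    case (incl h)
    then show ?case
      by (cases "h = []") (auto intro: generate.incl generate.one[where G = "free_group A", unfolded one])
  next
    case (inv h)
    then show ?case
      using F.inv_one
      by (cases "h = []") (auto intro: generate.inv generate.one[where G = "free_group A", unfolded one] simp: one)
  qed (auto intro: generate.one generate.eng)
  then have "K = generate (free_group A) (U - {[]})"
    using U(3) F.mono_generate[of "U - {[]}" U] by auto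
  moreover obtain us where "set us = U - {[]}"
    using finite_list[of "U - {[]}"] U(1) by auto
  moreover have "\<exists>S. fold_step\<^sup>*\<^sup>* (flower us) S \<and> deterministic S"
    by (rule folding_terminates[OF finite_states_flower edges_flower])
  ultimately show ?thesis
    using U(2) unfolding stallings_automaton_def by (metis Diff_mono order_refl)
qed

fun read_word :: "('v, 'a) automaton \<Rightarrow> 'v \<Rightarrow> 'a letter list \<Rightarrow> 'v option" where
  "read_word S q [] = Some q"
| "read_word S q (x # u) =
    (if \<exists>r. (q, x, r) \<in> edges S then read_word S (THE r. (q, x, r) \<in> edges S) u else None)"

definition transition :: "('v, 'a) automaton \<Rightarrow> 'a letter list \<Rightarrow> 'v \<rightharpoonup> 'v" where
  "transition S u = (\<lambda>q. read_word S q u) |` states S"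

text \<open>Composition is left to right: \<open>g \<circ>\<^sub>m f\<close> applies \<open>f\<close> first.\<close>

definition transition_monoid :: "'a set \<Rightarrow> ('v, 'a) automaton \<Rightarrow> ('v \<rightharpoonup> 'v) monoid" where
  "transition_monoid A S =
    \<lparr>carrier = {transition S u | u. u \<in> lists (A \<times> UNIV)},
     monoid.mult = (\<lambda>f g. g \<circ>\<^sub>m f), one = transition S []\<rparr>"

end

theory Submission
  imports Defs
begin

text \<open>
  Labelling each vertex of the flower by a right coset of \<open>K\<close> gives a morphism to the Schreier graph
  of \<open>K\<close>; folding only identifies vertices with equal labels, so the labelling survives and a word
  that loops at the basepoint of \<open>S\<close> represents an element of \<open>K\<close>.
  Conversely, the words read by a deterministic automaton with inverse edges are closed under free
  reduction, so every element of \<open>K\<close> loops at the basepoint.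

  If \<open>K\<close> is normal, conjugation shows that its elements loop at every state. A nontrivial normal
  subgroup contains, for every letter, a reduced word starting with it, hence all letters act as
  permutations, and \<open>\<delta>\<^sub>u\<close> is determined by the image of the basepoint, that is,
  \<open>\<delta>\<^sub>u \<mapsto> q\<^sub>0 \<cdot> u\<close> is a bijection from \<open>M(K)\<close> to \<open>Q\<close>.
  Conversely, if \<open>M(K)\<close> is a group, then all letters act as permutations, and this map is still
  onto; if the sizes agree it is injective, so elements of \<open>K\<close> act trivially and \<open>K\<close> is normal.
\<close>

section \<open>Words\<close>

definition word_inv :: "'a letter list \<Rightarrow> 'a letter list" where
  "word_inv w = rev (map letter_inv w)"

lemma word_inv_simps [simp]:
  "word_inv [] = []"
  "word_inv (x # w) = word_inv w @ [letter_inv x]"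
  "word_inv (u @ v) = word_inv v @ word_inv u"
  by (simp_all add: word_inv_def)

lemma word_inv_word_inv [simp]: "word_inv (word_inv w) = w"
  by (induction w) auto

lemma word_inv_lists [simp]: "word_inv w \<in> lists (A \<times> UNIV) \<longleftrightarrow> w \<in> lists (A \<times> UNIV)"
  by (induction w) (auto simp: letter_inv_def)

lemma letter_inv_eq_iff: "letter_inv x = y \<longleftrightarrow> x = letter_inv y"
  by auto

lemma reduced_word_inv: "reduced w \<Longrightarrow> reduced (word_inv w)"
  unfolding reduced_def word_inv_def
  by (auto simp: successively_map elim!: successively_mono)

lemma reduced_Cons: "reduced (x # w) \<longleftrightarrow> (w = [] \<or> hd w \<noteq> letter_inv x) \<and> reduced w"
  by (auto simp: reduced_def successively_Cons)

lemma reduced_snoc: "reduced (w @ [x]) \<longleftrightarrow> (w = [] \<or> x \<noteq> letter_inv (last w)) \<and> reduced w"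
  by (auto simp: reduced_def successively_append_iff)

lemma reduced_append: "reduced (u @ v) \<Longrightarrow> reduced u \<and> reduced v"
  by (auto simp: reduced_def successively_append_iff)

text \<open>Together with \<open>reduce_append_reduce\<close>, this flattens an iterated product in
  the free group to a single reduction of a concatenation.\<close>

lemma reduce_reduce_append: "reduce (reduce u @ v) = reduce (u @ v)"
  by (simp add: reduce_append foldr_reduce reduced_reduce)

lemma reduce_append_reduce: "reduce (u @ reduce v) = reduce (u @ v)"
  by (simp add: reduce_append reduce_reduced reduced_reduce)

lemma reduce_mem_free_group: "w \<in> lists (A \<times> UNIV) \<Longrightarrow> reduce w \<in> carrier (free_group A)"
  using reduce_lists by (auto simp: free_group_def reduced_reduce)

lemma free_group_carrierD:
  assumes "w \<in> carrier (free_group A)"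
  shows "w \<in> lists (A \<times> UNIV)" "reduced w"
  using assms by (auto simp: free_group_def)

lemma free_group_mult: "u \<otimes>\<^bsub>free_group A\<^esub> v = reduce (u @ v)"
  by (simp add: free_group_def)

lemma free_group_one: "\<one>\<^bsub>free_group A\<^esub> = []"
  by (simp add: free_group_def)

lemma free_group_inv:
  assumes "w \<in> carrier (free_group A)"
  shows "inv\<^bsub>free_group A\<^esub> w = word_inv w"
proof (rule group.inv_equality[OF group_free_group])
  show "word_inv w \<otimes>\<^bsub>free_group A\<^esub> w = \<one>\<^bsub>free_group A\<^esub>"
    by (simp add: free_group_mult free_group_one word_inv_def reduce_inverse)
  show "word_inv w \<in> carrier (free_group A)"
    using free_group_carrierD[OF assms] reduced_word_inv by (simp add: free_group_def)
qed fact

text \<open>A shortest nontrivial element \<open>k\<close> cannot have the form \<open>x\<^sup>-\<^sup>1 k' x\<close>, so \<open>k\<close> or its inverse does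
  not start with \<open>x\<^sup>-\<^sup>1\<close>, and the conjugate of that word by \<open>x\<close> starts with \<open>x\<close>.\<close>

lemma normal_has_element_starting_with:
  assumes N: "K \<lhd> free_group A" and "K \<noteq> {[]}" and x: "x \<in> A \<times> UNIV"
  obtains w where "x # w \<in> K"
proof -
  interpret F: group "free_group A" by (rule group_free_group)
  interpret N: normal K "free_group A" by (rule N)
  have car: "w \<in> carrier (free_group A)" if "w \<in> K" for w
    using that N.subset by auto
  have inv: "word_inv w \<in> K" if "w \<in> K" for w
    using N.m_inv_closed[OF that] free_group_inv[OF car[OF that]] by simp
  have letter: "[z] \<in> carrier (free_group A)" if "z \<in> A \<times> UNIV" for z
    using that by (auto simp: free_group_def reduced_def)
  have conj: "reduce (z # w @ [letter_inv z]) \<in> K" if "w \<in> K" "z \<in> A \<times> UNIV" for w z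
  proof -
    have "[z] \<otimes>\<^bsub>free_group A\<^esub> w \<otimes>\<^bsub>free_group A\<^esub> inv\<^bsub>free_group A\<^esub> [z] \<in> K"
      using N.inv_op_closed2[OF letter[OF that(2)] that(1)] .
    then show ?thesis
      by (simp add: free_group_inv[OF letter[OF that(2)]] free_group_mult reduce_reduce_append)
  qed
  obtain k0 where k0: "k0 \<in> K \<and> k0 \<noteq> []"
    using \<open>K \<noteq> {[]}\<close> N.one_closed by (auto simp: free_group_one)
  obtain k where k: "k \<in> K" "k \<noteq> []" and
    minimal: "\<And>w. w \<in> K \<Longrightarrow> w \<noteq> [] \<Longrightarrow> length k \<le> length w"
    using ex_has_least_nat[of "\<lambda>k. k \<in> K \<and> k \<noteq> []", OF k0, of length] by auto
  \<comment> \<open>In x w x^-1 nothing cancels on the left. On the right, at most the final x of w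
    cancels against x^-1, so the reduced conjugate still starts with x.\<close>
  have start: "\<exists>w. x # w \<in> K" if w: "w \<in> K" "w \<noteq> []" "hd w \<noteq> letter_inv x" for w
  proof -
    have red: "reduced w"
      using car[OF w(1)] by (rule free_group_carrierD)
    show ?thesis
    proof (cases "last w = x")
      case True
      then have weq: "w = butlast w @ [x]"
        using w(2) by (metis append_butlast_last_id)
      have hdx: "butlast w = [] \<or> hd (butlast w) \<noteq> letter_inv x"
        using w(2,3) weq by (metis hd_append2)
      have "reduced (x # butlast w)"
        using hdx red weq reduced_append by (metis reduced_Cons)
      have "reduce (x # w @ [letter_inv x]) = reduce ((x # butlast w) @ reduce [x, letter_inv x])"
        by (subst weq) (simp add: reduce_append_reduce[of "x # butlast w", simplified])
      also have "reduce [x, letter_inv x] = []"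
        by (simp add: reduce_def)
      finally have "reduce (x # w @ [letter_inv x]) = x # butlast w"
        using \<open>reduced (x # butlast w)\<close> by (simp add: reduce_reduced)
      then show ?thesis using conj[OF w(1) x] by metis
    next
      case False
      then have "reduced (w @ [letter_inv x])"
        using red by (auto simp: reduced_snoc letter_inv_eq_iff)
      then have "reduced (x # w @ [letter_inv x])"
        using w by (simp add: reduced_Cons)
      then show ?thesis
        using conj[OF w(1) x] by (auto simp: reduce_reduced)
    qed
  qed
  show thesis
  proof (cases "hd k = letter_inv x")
    case False
    then show thesis using start[OF k] that by blast
  next
    case True
    then obtain k' where k': "k = letter_inv x # k'"
      using k(2) by (cases k) auto
    show thesis
    proof (cases "hd (word_inv k) = letter_inv x")
      case False
      then show thesis using start[OF inv[OF k(1)]] k' that by auto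
    next
      case True
      \<comment> \<open>If k were the single letter x^-1, its inverse would start with x, and x
        differs from x^-1.\<close>
      have "k' \<noteq> []"
      proof
        assume "k' = []"
        then show False using True k' by (simp add: letter_inv_def prod_eq_iff)
      qed
      then have weq: "k' = butlast k' @ [last k']"
        by simp
      have "last k' = x"
        using True k' \<open>k' \<noteq> []\<close>
        by (metis append_is_Nil_conv hd_append2 hd_map hd_rev last_map letter_inv_inv map_is_Nil_conv
            rev_is_Nil_conv word_inv_def word_inv_simps(2))
      with weq have k'': "k = letter_inv x # butlast k' @ [x]"
        using k' by simp
      have red: "reduced k"
        using car[OF k(1)] by (rule free_group_carrierD)
      have "reduce (x # k @ [letter_inv x]) =
          reduce (reduce [x, letter_inv x] @ butlast k' @ reduce [x, letter_inv x])"
        by (simp only: reduce_reduce_append)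
          (simp add: k'' reduce_append_reduce[of "x # letter_inv x # butlast k'", simplified])
      also have "reduce [x, letter_inv x] = []"
        by (simp add: reduce_def)
      also have "reduce ([] @ butlast k' @ []) = butlast k'"
        using red k' weq reduced_append[of "butlast k'" "[last k']"]
        by (simp add: reduce_reduced reduced_Cons)
      finally have "butlast k' \<in> K"
        using conj[OF k(1) x] by simp
      \<comment> \<open>Otherwise k would be x^-1 x, which is not reduced. The conjugate is thus a
        nontrivial element two letters shorter than k.\<close>
      moreover have "butlast k' \<noteq> []"
        using red k'' by (auto simp: reduced_def)
      ultimately show thesis
        using minimal[of "butlast k'"] k'' by simp
    qed
  qed
qed

section \<open>Automata\<close>

text \<open>A relation rather than a function, because the automata met during folding need not be
  deterministic; the \<open>THE\<close> in \<open>read_word\<close> is meaningful only for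
  deterministic ones.\<close>

fun run :: "('v, 'a) automaton \<Rightarrow> 'v \<Rightarrow> 'a letter list \<Rightarrow> 'v \<Rightarrow> bool" where
  "run S p [] q \<longleftrightarrow> p = q"
| "run S p (x # w) q \<longleftrightarrow> (\<exists>r. (p, x, r) \<in> edges S \<and> run S r w q)"

lemma run_append: "run S p (u @ v) q \<longleftrightarrow> (\<exists>r. run S p u r \<and> run S r v q)"
  by (induction u arbitrary: p) auto

lemma run_map: "run S p w q \<Longrightarrow> run (map_automaton f S) (f p) w (f q)"
proof (induction w arbitrary: p)
  case (Cons x w)
  then show ?case
    by (force simp: map_automaton_def)
qed simp

text \<open>These properties pass to the image under an arbitrary map of vertices, so they survive
  every fold. Determinism is kept apart because it holds only at the end of the folding
  process.\<close>

locale inverse_automaton =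
  fixes A :: "'a set" and S :: "('v, 'a) automaton"
  assumes finite_states: "finite (states S)"
    and base_state: "base S \<in> states S"
    and edge_states: "(p, x, q) \<in> edges S \<Longrightarrow> p \<in> states S \<and> x \<in> A \<times> UNIV \<and> q \<in> states S"
    and inverse_edge: "(p, x, q) \<in> edges S \<Longrightarrow> (q, letter_inv x, p) \<in> edges S"
    and connected: "q \<in> states S \<Longrightarrow> \<exists>w. run S (base S) w q"
begin

lemma run_states: "run S p w q \<Longrightarrow> p \<in> states S \<Longrightarrow> q \<in> states S"
  by (induction w arbitrary: p) (auto dest: edge_states)

lemma run_lists: "run S p w q \<Longrightarrow> w \<in> lists (A \<times> UNIV)"
  by (induction w arbitrary: p) (auto dest: edge_states)

lemma run_word_inv: "run S p w q \<Longrightarrow> run S q (word_inv w) p"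
  by (induction w arbitrary: p) (auto simp: run_append intro: inverse_edge)

lemma inverse_automaton_map: "inverse_automaton A (map_automaton f S)"
proof
  fix q assume "q \<in> states (map_automaton f S)"
  then obtain p where p: "p \<in> states S" "q = f p"
    by (auto simp: map_automaton_def)
  obtain w where "run S (base S) w p"
    using connected p by blast
  from run_map[OF this, of f] show "\<exists>w. run (map_automaton f S) (base (map_automaton f S)) w q"
    using p by (auto simp: map_automaton_def)
next
  fix p x q assume "(p, x, q) \<in> edges (map_automaton f S)"
  then obtain p' q' where e: "(p', x, q') \<in> edges S" "p = f p'" "q = f q'"
    by (auto simp: map_automaton_def)
  then show "p \<in> states (map_automaton f S) \<and> x \<in> A \<times> UNIV \<and> q \<in> states (map_automaton f S)"
    using edge_states[OF e(1)] by (auto simp: map_automaton_def)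
  show "(q, letter_inv x, p) \<in> edges (map_automaton f S)"
    using inverse_edge[OF e(1)] e(2,3) by (force simp: map_automaton_def)
qed (auto simp: map_automaton_def finite_states base_state)

end

section \<open>Action of words on a deterministic automaton with inverse edges\<close>

locale deterministic_inverse_automaton = inverse_automaton +
  assumes det: "deterministic S"
begin

lemma run_deterministic: "run S p w q \<Longrightarrow> run S p w r \<Longrightarrow> q = r"
proof (induction w arbitrary: p)
  case (Cons x w)
  then show ?case using det unfolding deterministic_def by (metis run.simps(2))
qed simp

lemma run_reduce: "run S p w q \<Longrightarrow> run S p (reduce w) q"
proof (induction w arbitrary: p)
  case (Cons x w)
  then obtain r where r: "(p, x, r) \<in> edges S" "run S r (reduce w) q"
    by auto
  show ?case
  proof (cases "\<exists>w'. reduce w = letter_inv x # w'")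
    case True
    then obtain w' where w': "reduce w = letter_inv x # w'" by blast
    then have "run S p w' q"
      using r inverse_edge[OF r(1)] det unfolding deterministic_def by (metis run.simps(2))
    moreover have "reduce (x # w) = w'"
      using w' by (simp add: reduce_def)
    ultimately show ?thesis by simp
  next
    case False
    then have "reduce (x # w) = x # reduce w"
      by (cases "reduce w") (auto simp: reduce_def)
    then show ?thesis using r by auto
  qed
qed (simp add: reduce_def)

lemma read_word_eq_Some: "read_word S p w = Some q \<longleftrightarrow> run S p w q"
proof (induction w arbitrary: p)
  case (Cons x w)
  have "(THE r. (p, x, r) \<in> edges S) = r" if "(p, x, r) \<in> edges S" for r
    using that det unfolding deterministic_def by blast
  then show ?case
    using Cons det unfolding deterministic_def by auto
qed auto

lemma transition_eq_Some: "transition S w p = Some q \<longleftrightarrow> p \<in> states S \<and> run S p w q"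
  by (simp add: transition_def restrict_map_def read_word_eq_Some)

lemma transition_comp: "transition S v \<circ>\<^sub>m transition S u = transition S (u @ v)"
proof
  fix p
  have "(transition S v \<circ>\<^sub>m transition S u) p = Some q \<longleftrightarrow> transition S (u @ v) p = Some q" for q
    by (auto simp: map_comp_Some_iff transition_eq_Some run_append dest: run_states)
  then show "(transition S v \<circ>\<^sub>m transition S u) p = transition S (u @ v) p"
    by (metis option.exhaust_sel option.sel option.distinct(1))
qed

lemma transition_eqI:
  assumes "\<And>p q. p \<in> states S \<Longrightarrow> run S p u q \<longleftrightarrow> run S p v q"
  shows "transition S u = transition S v"
proof
  fix p
  have "transition S u p = Some q \<longleftrightarrow> transition S v p = Some q" for q
    using assms by (auto simp: transition_eq_Some)
  then show "transition S u p = transition S v p"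
    by (metis option.exhaust_sel option.sel option.distinct(1))
qed

lemma transition_eqD:
  assumes "transition S u = transition S v" "p \<in> states S"
  shows "run S p u q \<longleftrightarrow> run S p v q"
  using assms by (metis transition_eq_Some)

section \<open>Totality, the group property and the size of the transition monoid\<close>

definition total :: bool where
  "total \<longleftrightarrow> (\<forall>p\<in>states S. \<forall>w\<in>lists (A \<times> UNIV). \<exists>q. run S p w q)"

lemma totalI:
  assumes "\<And>p x. p \<in> states S \<Longrightarrow> x \<in> A \<times> UNIV \<Longrightarrow> \<exists>q. (p, x, q) \<in> edges S"
  shows total
  unfolding total_def
proof (intro ballI)
  fix p w assume "p \<in> states S" "w \<in> lists (A \<times> (UNIV :: bool set))"
  then show "\<exists>q. run S p w q"
  proof (induction w arbitrary: p)
    case (Cons x w)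
    then have "x \<in> A \<times> UNIV" "w \<in> lists (A \<times> UNIV)"
      by simp_all
    moreover from this obtain r where r: "(p, x, r) \<in> edges S"
      using assms Cons.prems(1) by blast
    ultimately show ?case
      using Cons.IH[of r] edge_states[OF r] by auto
  qed (metis run.simps(1))
qed

text \<open>Without totality, w may be unreadable where \<open>reduce w\<close> is readable.
  Totality supplies an endpoint for w, and determinism identifies it with that of
  \<open>reduce w\<close>.\<close>

lemma run_reduce_iff:
  assumes total "p \<in> states S" "w \<in> lists (A \<times> UNIV)"
  shows "run S p (reduce w) q \<longleftrightarrow> run S p w q"
  using assms run_reduce run_deterministic unfolding total_def by metis

text \<open>An inverse of the action of a letter forces that action to be defined at every state.
  Conversely, under totality u^-1 u acts like its reduction, the empty word.\<close>

lemma group_transition_monoid_iff: "group (transition_monoid A S) \<longleftrightarrow> total"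
proof
  assume "group (transition_monoid A S)"
  then interpret M: group "transition_monoid A S" .
  show total
  proof (rule totalI)
    fix p x assume p: "p \<in> states S" and x: "x \<in> A \<times> (UNIV :: bool set)"
    have mem: "transition S [x] \<in> carrier (transition_monoid A S)"
      using x by (auto simp: transition_monoid_def)
    \<comment> \<open>Multiplication applies its left factor first, so the right inverse is the map
      applied after the letter.\<close>
    obtain g where g: "g \<circ>\<^sub>m transition S [x] = transition S []"
      using M.r_inv[OF mem] by (auto simp: transition_monoid_def)
    have "(g \<circ>\<^sub>m transition S [x]) p = Some p"
      using p by (simp add: g transition_eq_Some)
    then show "\<exists>q. (p, x, q) \<in> edges S"
      by (auto simp: map_comp_Some_iff transition_eq_Some)
  qed
next
  assume total: total
  show "group (transition_monoid A S)"
  proof (rule groupI)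
    fix f assume "f \<in> carrier (transition_monoid A S)"
    then obtain u where u: "u \<in> lists (A \<times> UNIV)" "f = transition S u"
      by (auto simp: transition_monoid_def)
    have eq: "transition S (word_inv u @ u) = transition S []"
    proof (rule transition_eqI)
      fix p q assume p: "p \<in> states S"
      have "reduce (word_inv u @ u) = []"
        by (simp add: word_inv_def reduce_inverse)
      then show "run S p (word_inv u @ u) q \<longleftrightarrow> run S p [] q"
        using run_reduce_iff[OF total p, of "word_inv u @ u" q] u(1) by auto
    qed
    have "transition S (word_inv u) \<in> carrier (transition_monoid A S)"
      using iffD2[OF word_inv_lists u(1)] by (auto simp only: transition_monoid_def partial_object.simps)
    then show "\<exists>g\<in>carrier (transition_monoid A S).
        g \<otimes>\<^bsub>transition_monoid A S\<^esub> f = \<one>\<^bsub>transition_monoid A S\<^esub>"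
      using eq by (intro bexI[of _ "transition S (word_inv u)"])
        (simp_all add: transition_monoid_def transition_comp u(2))
  next
    fix f g assume "f \<in> carrier (transition_monoid A S)" "g \<in> carrier (transition_monoid A S)"
    then obtain u v where "u \<in> lists (A \<times> UNIV)" "f = transition S u"
      "v \<in> lists (A \<times> UNIV)" "g = transition S v"
      by (auto simp: transition_monoid_def)
    then show "f \<otimes>\<^bsub>transition_monoid A S\<^esub> g \<in> carrier (transition_monoid A S)"
      by (auto simp: transition_monoid_def transition_comp intro!: exI[of _ "u @ v"])
  qed (auto simp: transition_monoid_def transition_comp intro!: exI[of _ "[]"])
qed

lemma base_image:
  assumes total
  shows "(\<lambda>f. the (f (base S))) ` carrier (transition_monoid A S) = states S"
proof (intro equalityI subsetI)
  fix q assume "q \<in> (\<lambda>f. the (f (base S))) ` carrier (transition_monoid A S)"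
  then obtain u where u: "u \<in> lists (A \<times> UNIV)" "q = the (transition S u (base S))"
    by (auto simp: transition_monoid_def)
  obtain r where "run S (base S) u r"
    using assms u(1) base_state unfolding total_def by blast
  then have "transition S u (base S) = Some r" "r \<in> states S"
    using base_state run_states by (auto simp: transition_eq_Some)
  then show "q \<in> states S" using u by simp
next
  fix q assume "q \<in> states S"
  then obtain w where w: "run S (base S) w q"
    using connected by blast
  then have "transition S w (base S) = Some q"
    using base_state by (simp add: transition_eq_Some)
  moreover have "transition S w \<in> carrier (transition_monoid A S)"
    using run_lists[OF w] by (auto simp: transition_monoid_def)
  ultimately show "q \<in> (\<lambda>f. the (f (base S))) ` carrier (transition_monoid A S)"
    by (force simp: image_iff)
qed

lemma order_eq_card_iff:
  assumes total
  shows "order (transition_monoid A S) = card (states S) \<longleftrightarrow>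
    inj_on (\<lambda>f. the (f (base S))) (carrier (transition_monoid A S))"
proof
  assume eq: "order (transition_monoid A S) = card (states S)"
  \<comment> \<open>\<open>order\<close> is 0 on an infinite carrier, so a nonzero number of states
    is what yields finiteness of the monoid.\<close>
  have "card (states S) \<noteq> 0"
    using finite_states base_state by auto
  then have "finite (carrier (transition_monoid A S))"
    using eq unfolding order_def by (metis card.infinite)
  then show "inj_on (\<lambda>f. the (f (base S))) (carrier (transition_monoid A S))"
    by (rule eq_card_imp_inj_on) (use eq in \<open>simp add: base_image[OF assms] order_def\<close>)
next
  assume "inj_on (\<lambda>f. the (f (base S))) (carrier (transition_monoid A S))"
  from card_image[OF this] show "order (transition_monoid A S) = card (states S)"
    by (simp add: base_image[OF assms] order_def)
qed

end

section \<open>Normality of a subgroup in terms of its automaton\<close>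

text \<open>All that the equivalence needs from the Stallings construction. Loops may carry
  unreduced labels, whereas elements of \<open>K\<close> are reduced words; hence
  \<open>reduce\<close> in one direction only.\<close>

locale subgroup_automaton = deterministic_inverse_automaton +
  fixes K
  assumes subgroup: "subgroup K (free_group A)"
    and loop_in_subgroup: "run S (base S) w (base S) \<Longrightarrow> reduce w \<in> K"
    and subgroup_loop: "k \<in> K \<Longrightarrow> run S (base S) k (base S)"
begin

text \<open>If g labels a path from the basepoint to q, then g k g^-1 lies in \<open>K\<close> and
  loops at the basepoint. Going back along g, around this loop and out along g again is a loop at q
  whose label reduces to k.\<close>

lemma normal_loop:
  assumes "K \<lhd> free_group A" "k \<in> K" "q \<in> states S"
  shows "run S q k q"
proof -
  interpret F: group "free_group A" by (rule group_free_group)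
  interpret N: normal K "free_group A" by fact
  obtain w where w: "run S (base S) w q"
    using connected assms by blast
  \<comment> \<open>Reducing the label makes it an element of the free group while keeping the
    endpoint q.\<close>
  define g where "g = reduce w"
  have g: "run S (base S) g q" "g \<in> carrier (free_group A)"
    using w run_reduce run_lists reduce_mem_free_group unfolding g_def by blast+
  have k: "k \<in> carrier (free_group A)"
    using assms N.subset by auto
  let ?c = "g \<otimes>\<^bsub>free_group A\<^esub> k \<otimes>\<^bsub>free_group A\<^esub> inv\<^bsub>free_group A\<^esub> g"
  have "?c \<in> K"
    using N.inv_op_closed2[OF g(2) assms(2)] .
  then have "run S q (word_inv g @ ?c @ g) q"
    using g(1) run_word_inv subgroup_loop unfolding run_append by blast
  then have "run S q (reduce (word_inv g @ ?c @ g)) q"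
    by (rule run_reduce)
  moreover have "reduce (word_inv g @ ?c @ g) =
      inv\<^bsub>free_group A\<^esub> g \<otimes>\<^bsub>free_group A\<^esub> (?c \<otimes>\<^bsub>free_group A\<^esub> g)"
    by (simp add: free_group_inv[OF g(2)] free_group_mult[where u = "word_inv g"]
        free_group_mult[where v = g] reduce_append_reduce)
  moreover have "\<dots> = k"
    using g k by (simp add: F.m_assoc F.inv_solve_left')
  ultimately show ?thesis by simp
qed

text \<open>Some element of \<open>K\<close> starts with x and loops at q, so x is readable there.
  The trivial subgroup has to be excluded: a single vertex without edges is not total when
  \<open>A\<close> is nonempty.\<close>

lemma normal_total:
  assumes "K \<lhd> free_group A" "K \<noteq> {[]}"
  shows total
proof (rule totalI)
  fix q x assume q: "q \<in> states S" and x: "x \<in> A \<times> (UNIV :: bool set)"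
  obtain w where "x # w \<in> K"
    using normal_has_element_starting_with[OF assms x] .
  then have "run S q (x # w) q"
    using normal_loop assms q by blast
  then show "\<exists>r. (q, x, r) \<in> edges S"
    by auto
qed

text \<open>If u and v take the basepoint to the same state, then u v^-1 represents an element of
  \<open>K\<close>. By normality this element loops everywhere, so u and v agree at every
  state.\<close>

lemma normal_inj:
  assumes "K \<lhd> free_group A" "total"
  shows "inj_on (\<lambda>f. the (f (base S))) (carrier (transition_monoid A S))"
proof (rule inj_onI)
  fix f g assume fg: "f \<in> carrier (transition_monoid A S)" "g \<in> carrier (transition_monoid A S)"
    "the (f (base S)) = the (g (base S))"
  then obtain u v where u: "u \<in> lists (A \<times> UNIV)" "f = transition S u"
    and v: "v \<in> lists (A \<times> UNIV)" "g = transition S v"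
    by (auto simp: transition_monoid_def)
  obtain q r where qr: "run S (base S) u q" "run S (base S) v r"
    using assms(2) u v base_state unfolding total_def by blast
  then have "f (base S) = Some q" "g (base S) = Some r"
    using u v base_state by (auto simp: transition_eq_Some)
  then have "q = r" using fg by simp
  then have "run S (base S) (u @ word_inv v) (base S)"
    using qr run_word_inv by (auto simp: run_append)
  then have K: "reduce (u @ word_inv v) \<in> K"
    by (rule loop_in_subgroup)
  have "run S p u s \<longleftrightarrow> run S p v s" if p: "p \<in> states S" for p s
  proof -
    \<comment> \<open>Totality lifts the loop from the reduced word to the unreduced one, which can
      be split between u and the inverse of v.\<close>
    have "run S p (u @ word_inv v) p"
      using normal_loop[OF assms(1) K p] run_reduce_iff[OF assms(2) p] u v by simp
    then obtain t where "run S p u t" "run S t (word_inv v) p"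
      by (auto simp: run_append)
    then have "run S p u t" "run S p v t"
      using run_word_inv[of t "word_inv v" p] by simp_all
    then show ?thesis using run_deterministic by blast
  qed
  then show "f = g"
    unfolding u(2) v(2) by (rule transition_eqI)
qed

text \<open>Each k in \<open>K\<close> fixes the basepoint, as the empty word does, so by
  injectivity it acts as the identity. Hence g k g^-1 loops at the basepoint.\<close>

lemma inj_normal:
  assumes total "inj_on (\<lambda>f. the (f (base S))) (carrier (transition_monoid A S))"
  shows "K \<lhd> free_group A"
proof -
  interpret F: group "free_group A" by (rule group_free_group)
  show ?thesis
  proof (subst F.normal_inv_iff, intro conjI ballI)
    show "subgroup K (free_group A)" by (rule subgroup)
  next
    fix g k assume g: "g \<in> carrier (free_group A)" and k: "k \<in> K"
    have kl: "k \<in> lists (A \<times> UNIV)"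
      using k subgroup.subset[OF subgroup] free_group_carrierD by blast
    have "transition S k = transition S []"
    proof (rule inj_onD[OF assms(2)])
      have "transition S k (base S) = Some (base S)" "transition S [] (base S) = Some (base S)"
        using subgroup_loop[OF k] base_state by (simp_all add: transition_eq_Some)
      then show "the (transition S k (base S)) = the (transition S [] (base S))"
        by simp
      show "transition S k \<in> carrier (transition_monoid A S)"
        using kl by (auto simp: transition_monoid_def)
      show "transition S [] \<in> carrier (transition_monoid A S)"
        by (auto simp: transition_monoid_def intro!: exI[of _ "[]"])
    qed
    then have loop: "run S q k q" if "q \<in> states S" for q
      using transition_eqD[OF _ that] by fastforce
    \<comment> \<open>Totality is what makes an arbitrary g readable from the basepoint.\<close>
    obtain q where q: "run S (base S) g q"
      using assms(1) base_state free_group_carrierD[OF g] unfolding total_def by blast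
    then have "run S (base S) (g @ k @ word_inv g) (base S)"
      using q loop run_word_inv run_states[OF q base_state] unfolding run_append by blast
    then have "reduce (g @ k @ word_inv g) \<in> K"
      by (rule loop_in_subgroup)
    then show "g \<otimes>\<^bsub>free_group A\<^esub> k \<otimes>\<^bsub>free_group A\<^esub> inv\<^bsub>free_group A\<^esub> g \<in> K"
      by (simp add: free_group_inv[OF g] free_group_mult reduce_reduce_append)
  qed
qed

end

section \<open>Folding\<close>

text \<open>Proper prefixes reach the petal vertices, which gives connectedness; the bound includes
  the full length, where the path closes up at \<open>Base\<close>.\<close>

lemma run_petal:
  assumes i: "i < length us" and "j \<le> length (us ! i)"
  shows "run (flower us) Base (take j (us ! i)) (petal_vertex us i j)"
  using assms(2)
proof (induction j)
  case (Suc j)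
  then have "(petal_vertex us i j, us ! i ! j, petal_vertex us i (Suc j)) \<in> petal_edges us"
    using i Suc_le_lessD unfolding petal_edges_def by blast
  then have "(petal_vertex us i j, us ! i ! j, petal_vertex us i (Suc j)) \<in> edges (flower us)"
    by (simp add: flower_def)
  then show ?case
    using Suc by (auto simp: take_Suc_conv_app_nth run_append simp del: split_paired_Ex)
qed (simp add: petal_vertex_def)

lemma inverse_automaton_flower:
  assumes "set us \<subseteq> lists (A \<times> UNIV)"
  shows "inverse_automaton A (flower us)"
proof
  fix p x q assume e: "(p, x, q) \<in> edges (flower us)"
  have "us ! i ! j \<in> A \<times> UNIV" if "i < length us" "j < length (us ! i)" for i j
    using that assms by (meson in_lists_conv_set nth_mem subsetD)
  then have "x \<in> A \<times> UNIV"
    using e by (fastforce simp: flower_def petal_edges_def letter_inv_def)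
  then show "p \<in> states (flower us) \<and> x \<in> A \<times> UNIV \<and> q \<in> states (flower us)"
    using edges_flower[OF e] by simp
  show "(q, letter_inv x, p) \<in> edges (flower us)"
    using e letter_inv_inv[of x] unfolding flower_def automaton.simps by fastforce
next
  fix q assume "q \<in> states (flower us)"
  then consider "q = Base" | i j where "i < length us" "j < length (us ! i)" "q = petal_vertex us i j"
    by (auto simp: flower_def)
  then have "\<exists>w. run (flower us) Base w q"
    by cases (metis run.simps(1), metis run_petal less_imp_le)
  then show "\<exists>w. run (flower us) (base (flower us)) w q"
    by (simp add: flower_def)
qed (auto simp: finite_states_flower, simp add: flower_def)

text \<open>A morphism from the automaton to the Schreier graph of \<open>K\<close>.\<close>

definition coset_labelling ::
  "'a set \<Rightarrow> 'a letter list set \<Rightarrow> ('v \<Rightarrow> 'a letter list set) \<Rightarrow> ('v, 'a) automaton \<Rightarrow> bool" where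
  "coset_labelling A K h S \<longleftrightarrow>
    h (base S) = K \<and> (\<forall>(p, x, q)\<in>edges S. h q = h p #>\<^bsub>free_group A\<^esub> [x])"

text \<open>The two targets being merged carry the same label, that of p times x, so the same
  \<open>h\<close> still labels the folded automaton.\<close>

lemma coset_labelling_fold:
  assumes "coset_labelling A K h S" "fold_step S T"
  shows "coset_labelling A K h T"
  using assms(2)
proof cases
  case (1 p x q r)
  have edge: "h b = h a #>\<^bsub>free_group A\<^esub> [y]" if "(a, y, b) \<in> edges S" for a y b
    using assms(1) that by (auto simp: coset_labelling_def)
  have "h q = h r"
    using edge[OF 1(2)] edge[OF 1(3)] by simp
  then have h: "h ((id(r := q)) v) = h v" for v
    by simp
  show ?thesis
    using assms(1) edge unfolding 1(1) coset_labelling_def map_automaton_def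
    by (auto simp: h simp del: fun_upd_apply)
qed

text \<open>The starting label must lie in the carrier so that successive coset multiplications can
  be reassociated along the path.\<close>

lemma coset_labelling_run:
  assumes "coset_labelling A K h S" "run S p w q" "h p \<subseteq> carrier (free_group A)"
    and "w \<in> lists (A \<times> UNIV)"
  shows "h q = h p #>\<^bsub>free_group A\<^esub> reduce w"
  using assms(2-)
proof (induction w arbitrary: p)
  case Nil
  then show ?case
    using group.coset_mult_one[OF group_free_group, of "h q" A]
    by (simp add: reduce_def free_group_one)
next
  case (Cons x w)
  interpret F: group "free_group A" by (rule group_free_group)
  obtain r where r: "(p, x, r) \<in> edges S" "run S r w q"
    using Cons by auto
  have x: "[x] \<in> carrier (free_group A)"
    using Cons.prems(3) by (auto simp: free_group_def reduced_def)
  have hr: "h r = h p #>\<^bsub>free_group A\<^esub> [x]"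
    using assms(1) r by (auto simp: coset_labelling_def)
  then have "h r \<subseteq> carrier (free_group A)"
    using F.r_coset_subset_G Cons.prems x by simp
  then have "h q = h p #>\<^bsub>free_group A\<^esub> [x] #>\<^bsub>free_group A\<^esub> reduce w"
    using Cons r hr by simp
  also have "\<dots> = h p #>\<^bsub>free_group A\<^esub> reduce (x # w)"
    using F.coset_mult_assoc[OF Cons.prems(2) x, of "reduce w"] reduce_mem_free_group[of w A]
      Cons.prems reduce_append_reduce[of "[x]" w]
    by (simp add: free_group_mult)
  finally show ?case .
qed

text \<open>A petal vertex is labelled by the coset of the prefix leading to it. The last edge of a
  petal is consistent because the generator lies in \<open>K\<close>, so its coset is
  \<open>K\<close> itself.\<close>

lemma coset_labelling_flower:
  assumes us: "set us \<subseteq> K" and K: "subgroup K (free_group A)"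
  shows "coset_labelling A K
    (\<lambda>v. case v of Base \<Rightarrow> K | Petal i j \<Rightarrow> K #>\<^bsub>free_group A\<^esub> take j (us ! i)) (flower us)"
    (is "coset_labelling A K ?h _")
proof -
  interpret F: group "free_group A" by (rule group_free_group)
  note sub = subgroup.subset[OF K]
  have car: "us ! i \<in> carrier (free_group A)" if "i < length us" for i
    using that us sub by (meson nth_mem subsetD)
  have takecar: "take j (us ! i) \<in> carrier (free_group A)" if "i < length us" for i j
  proof -
    have "reduced (take j (us ! i))"
      using free_group_carrierD(2)[OF car[OF that]] reduced_append append_take_drop_id by metis
    then show ?thesis
      using free_group_carrierD(1)[OF car[OF that]] set_take_subset[of j "us ! i"]
      by (auto simp: free_group_def)
  qed
  have h: "?h (petal_vertex us i j) = K #>\<^bsub>free_group A\<^esub> take j (us ! i)"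
    if "i < length us" "j \<le> length (us ! i)" for i j
  proof -
    have "K #>\<^bsub>free_group A\<^esub> us ! i = K"
      using that us by (intro F.coset_join2[OF car K]) (auto intro: nth_mem)
    then show ?thesis
      using that F.coset_mult_one[OF sub] by (auto simp: petal_vertex_def free_group_one)
  qed
  \<comment> \<open>The second equation handles the inverse edges of the flower.\<close>
  have edge: "?h q = ?h p #>\<^bsub>free_group A\<^esub> [x] \<and> ?h p = ?h q #>\<^bsub>free_group A\<^esub> [letter_inv x]"
    if e: "(p, x, q) \<in> petal_edges us" for p x q
  proof -
    obtain i j where ij: "i < length us" "j < length (us ! i)" "p = petal_vertex us i j"
      "x = us ! i ! j" "q = petal_vertex us i (Suc j)"
      using e by (auto simp: petal_edges_def)
    let ?u = "take j (us ! i)"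
    have "us ! i ! j \<in> A \<times> UNIV"
      using free_group_carrierD(1)[OF car[OF ij(1)]] ij(2) by (meson in_lists_conv_set nth_mem)
    then have x: "[x] \<in> carrier (free_group A)" "[letter_inv x] = inv\<^bsub>free_group A\<^esub> [x]"
      using free_group_inv[of "[x]" A] ij(4) by (auto simp: free_group_def reduced_def)
    have u: "?u \<in> carrier (free_group A)"
      using takecar ij by blast
    have "take (Suc j) (us ! i) = ?u @ [x]"
      using ij by (simp add: take_Suc_conv_app_nth)
    then have "take (Suc j) (us ! i) = ?u \<otimes>\<^bsub>free_group A\<^esub> [x]"
      using free_group_carrierD(2)[OF takecar[OF ij(1), of "Suc j"]]
      by (simp add: free_group_mult reduce_reduced)
    then have q: "?h q = K #>\<^bsub>free_group A\<^esub> (?u \<otimes>\<^bsub>free_group A\<^esub> [x])"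
      and p: "?h p = K #>\<^bsub>free_group A\<^esub> ?u"
      using h[of i j] h[of i "Suc j"] ij by simp_all
    show ?thesis
      unfolding p q x(2)
      using F.coset_mult_assoc[OF sub] u x(1) by (simp add: F.m_assoc)
  qed
  have "?h q = ?h p #>\<^bsub>free_group A\<^esub> [x]" if e: "(p, x, q) \<in> edges (flower us)" for p x q
  proof -
    from e consider "(p, x, q) \<in> petal_edges us"
      | y where "x = letter_inv y" "(q, y, p) \<in> petal_edges us"
      by (auto simp: flower_def)
    then show ?thesis
    proof cases
      case 1
      show ?thesis using conjunct1[OF edge[OF 1]] .
    next
      case 2
      show ?thesis using conjunct2[OF edge[OF 2(2)]] unfolding 2(1) .
    qed
  qed
  moreover have "?h (base (flower us)) = K"
    by (simp add: flower_def)
  ultimately show ?thesis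
    unfolding coset_labelling_def by fast
qed

text \<open>A loop w at the basepoint gives K = K w, hence \<open>reduce w\<close> lies in
  \<open>K\<close>. Conversely, generators loop along their petals, and labels of loops at the
  basepoint are closed under inversion, concatenation and reduction.\<close>

lemma stallings_automaton_subgroup_automaton:
  assumes K: "subgroup K (free_group A)" and "stallings_automaton A K S"
  shows "subgroup_automaton A S K"
proof -
  interpret F: group "free_group A" by (rule group_free_group)
  obtain us where us: "set us \<subseteq> carrier (free_group A) - {[]}"
    and gen: "K = generate (free_group A) (set us)"
    and fold: "fold_step\<^sup>*\<^sup>* (flower us) S" and det: "deterministic S"
    using assms(2) by (auto simp: stallings_automaton_def)
  have usK: "set us \<subseteq> K"
    unfolding gen by (auto intro: generate.incl)
  have usl: "set us \<subseteq> lists (A \<times> UNIV)"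
    using us free_group_carrierD by blast
  obtain h where h: "coset_labelling A K h (flower us)"
    using coset_labelling_flower[OF usK K] by blast
  have petal: "run (flower us) (base (flower us)) u (base (flower us))" if u: "u \<in> set us" for u
  proof -
    obtain i where "i < length us" "us ! i = u"
      using u by (auto simp: in_set_conv_nth)
    then show ?thesis
      using run_petal[of i us "length u"] by (simp add: flower_def petal_vertex_def)
  qed
  \<comment> \<open>Invariants of folding; none of them refers to determinism, which may fail before
    the last step.\<close>
  from fold have "inverse_automaton A S \<and> coset_labelling A K h S \<and>
      (\<forall>u\<in>set us. run S (base S) u (base S))"
  proof induction
    case base
    then show ?case
      using inverse_automaton_flower[OF usl] h petal by blast
  next
    case (step S T)
    then obtain f where T: "T = map_automaton f S"
      by (auto elim: fold_step.cases)
    then have "base T = f (base S)"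
      by (simp add: map_automaton_def)
    then show ?case
      using step inverse_automaton.inverse_automaton_map coset_labelling_fold run_map
      unfolding T by metis
  qed
  then have inverse: "inverse_automaton A S" and h: "coset_labelling A K h S"
    and loops: "\<And>u. u \<in> set us \<Longrightarrow> run S (base S) u (base S)"
    by auto
  interpret D: deterministic_inverse_automaton A S
    using inverse det
    by (simp add: deterministic_inverse_automaton_def deterministic_inverse_automaton_axioms_def)
  show ?thesis
  proof (intro subgroup_automaton.intro subgroup_automaton_axioms.intro)
    show "deterministic_inverse_automaton A S" ..
  next
    fix w assume w: "run S (base S) w (base S)"
    have hb: "h (base S) = K"
      using h by (simp add: coset_labelling_def)
    have wl: "w \<in> lists (A \<times> UNIV)"
      using D.run_lists[OF w] .
    have "K = K #>\<^bsub>free_group A\<^esub> reduce w"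
      using coset_labelling_run[OF h w _ wl] subgroup.subset[OF K] hb by simp
    then show "reduce w \<in> K"
      using F.coset_join1[OF _ _ K] reduce_mem_free_group[OF wl] by metis
  next
    fix k assume "k \<in> K"
    then show "run S (base S) k (base S)"
      unfolding gen
    proof (induction rule: generate.induct)
      case (inv u)
      then have "u \<in> carrier (free_group A)" using us by auto
      then show ?case
        using D.run_word_inv loops[OF inv] by (simp add: free_group_inv)
    next
      case (eng u v)
      then have "run S (base S) (u @ v) (base S)"
        by (auto simp: run_append)
      then show ?case
        by (simp add: free_group_mult D.run_reduce)
    qed (auto simp: free_group_one loops)
  qed (rule K)
qed

theorem theorem6p6:
  fixes A :: "'a set" and K :: "'a letter list set" and S :: "(vertex, 'a) automaton"
  assumes "finite A"
    and "subgroup K (free_group A)"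
    and "finitely_generated (free_group A) K"
    and "K \<noteq> {\<one>\<^bsub>free_group A\<^esub>}"
    and "stallings_automaton A K S"
  shows "K \<lhd> free_group A \<longleftrightarrow>
    group (transition_monoid A S) \<and> order (transition_monoid A S) = card (states S)"
proof -
  interpret subgroup_automaton A S K
    using assms(2,5) by (rule stallings_automaton_subgroup_automaton)
  have "K \<noteq> {[]}"
    using assms(4) by (simp add: free_group_one)
  then show ?thesis
    using group_transition_monoid_iff order_eq_card_iff normal_total normal_inj inj_normal by blast
qed

end
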